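(* Let $U\subseteq\mathbb{R}^d$ be finite. Then for every $\varepsilon>0$ there is a family of $\varepsilon$-containers for $\mathsf{HS}(U)$ of size $(d/\varepsilon)^{O(d)}$.
   Context: A halfspace in $\mathbb{R}^d$ is a set of the form $\{x:\langle a,x\rangle< b\}$ or $\{x:\langle a,x\rangle\le b\}$; $\mathsf{HS}_d$ is the family of all halfspaces in $\mathbb{R}^d$ and $\mathsf{HS}(U)=\{H\cap U: H\in\mathsf{HS}_d\}$. For a finite set $X$ and a family $\mathcal{F}\subseteq 2^X$, a family $\mathcal{C}\subseteq 2^X$ is a family of $\varepsilon$-containers for $\mathcal{F}$ if for every $F\in\mathcal{F}$ there exists $C\in\mathcal{C}$ with $F\subseteq C$ and $|C\setminus F|\le\varepsilon|X|$.
   Formalization: The size bound is proved as max(2, d/ε)^{O(d)} for d ≥ 1 with an absolute constant; the literal (d/ε)^{O(d)} fails for ε > d (it is below 1) and for d = 1 with ε just below 1, where two containers are needed. The base is d/ε whenever d/ε ≥ 2. *)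

theory Defs
  imports Complex_Main "Jordan_Normal_Form.Matrix"
begin

text \<open>
  The constant hidden in the exponent \<open>O(d)\<close> is absolute, so the dimension is quantified
  inside the theorem; \<open>\<real>\<^sup>d\<close> is therefore the carrier \<open>carrier_vec d :: real vec set\<close>.

  The size bound \<open>(d/\<epsilon>)\<^bsup>O(d)\<^esup>\<close> presupposes that \<open>d/\<epsilon>\<close> is bounded away from 1: for \<open>\<epsilon> > d\<close>
  it is below 1, and for \<open>d = 1\<close> and \<open>\<epsilon> < 1\<close> near 1 it is below 2 although the traces \<open>{}\<close> and
  \<open>U\<close> of a nonempty \<open>U\<close> have no common container. The theorem uses \<open>max 2 (d/\<epsilon>)\<close> as the base,
  which is \<open>d/\<epsilon>\<close> whenever \<open>d \<ge> 2\<close> and \<open>\<epsilon> \<le> 1\<close>, or \<open>d = 1\<close> and \<open>\<epsilon> \<le> 1/2\<close>.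
\<close>

definition halfspaces :: "nat \<Rightarrow> real vec set set" where
  "halfspaces d =
     {{x \<in> carrier_vec d. a \<bullet> x < b} | a b. a \<in> carrier_vec d} \<union>
     {{x \<in> carrier_vec d. a \<bullet> x \<le> b} | a b. a \<in> carrier_vec d}"

definition halfspace_traces :: "nat \<Rightarrow> real vec set \<Rightarrow> real vec set set" where
  "halfspace_traces d U = {H \<inter> U | H. H \<in> halfspaces d}"

text \<open>Meant for finite \<open>X\<close> and \<open>\<F> \<subseteq> Pow X\<close>.\<close>

definition eps_containers :: "real \<Rightarrow> 'a set \<Rightarrow> 'a set set \<Rightarrow> 'a set set \<Rightarrow> bool" where
  "eps_containers \<epsilon> X \<F> \<C> \<longleftrightarrow>
     \<C> \<subseteq> Pow X \<and>
     (\<forall>F\<in>\<F>. \<exists>C\<in>\<C>. F \<subseteq> C \<and> real (card (C - F)) \<le> \<epsilon> * real (card X))"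

end

theory Submission
  imports Defs "HOL-Library.FuncSet"
begin

text \<open>
  Work in the dual: a halfspace is an element \<open>h\<close> of the \<open>(d + 1)\<close>-dimensional space \<open>W\<close> of affine
  functionals restricted to \<open>U\<close>, and its trace is \<open>{h > 0}\<close>. A sample \<open>S \<subseteq> U\<close> of polynomial size in
  \<open>d/\<epsilon>\<close> cuts \<open>W\<close> into \<open>|S|\<^bsup>O(d)\<^esup>\<close> cones, and each cone is split into simplicial cones as in a bottom
  vertex triangulation: starting at \<open>h\<close>, shoot a ray away from an extreme ray chosen canonically in
  the current face until a facet \<open>s = 0\<close> is hit, and continue in that facet. So \<open>h\<close> is a positive
  combination of at most \<open>d + 1\<close> extreme rays \<open>v\<^sub>i\<close>, which are determined by the cone and the sequence
  of facets; there are \<open>|S|\<^bsup>O(d)\<^esup>\<close> such sequences. The container is the set of points where some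
  \<open>v\<^sub>i\<close> is positive. A superfluous point has \<open>v\<^sub>i > 0 > v\<^sub>j\<close> for some \<open>i, j\<close>, whereas no point of \<open>S\<close>
  does. Up to scaling an extreme ray is determined by at most \<open>d + 1\<close> points of \<open>S\<close>, so a union bound
  over tuples of sample points shows that for a random \<open>S\<close> there are few superfluous points.
\<close>

section \<open>Function spaces and their dimension\<close>

definition lin_closed :: "('p \<Rightarrow> real) set \<Rightarrow> bool" where
  "lin_closed W \<longleftrightarrow> (\<forall>w\<in>W. \<forall>w'\<in>W. \<forall>a b. (\<lambda>p. a * w p + b * w' p) \<in> W)"

definition vanishing :: "('p \<Rightarrow> real) set \<Rightarrow> 'p set \<Rightarrow> ('p \<Rightarrow> real) set" where
  "vanishing W T = {w \<in> W. \<forall>s\<in>T. w s = 0}"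

text \<open>
  Only the length of chains of vanishing conditions matters below, so dimension is defined by it;
  this avoids bases and works for all \<open>d\<close> in a single type.
\<close>

primrec dim_le :: "nat \<Rightarrow> ('p \<Rightarrow> real) set \<Rightarrow> bool" where
  "dim_le 0 W \<longleftrightarrow> (\<forall>w\<in>W. \<forall>p. w p = 0)"
| "dim_le (Suc m) W \<longleftrightarrow> (\<forall>s. (\<exists>w\<in>W. w s \<noteq> 0) \<longrightarrow> dim_le m (vanishing W {s}))"

lemma lin_closedD:
  "lin_closed W \<Longrightarrow> w \<in> W \<Longrightarrow> w' \<in> W \<Longrightarrow> (\<lambda>p. a * w p + b * w' p) \<in> W"
  by (simp add: lin_closed_def)

lemma lin_closed_diff:
  assumes "lin_closed W" "w \<in> W" "w' \<in> W"
  shows "(\<lambda>p. w p - t * w' p) \<in> W"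
  using lin_closedD[OF assms, of 1 "-t"] by simp

lemma lin_closed_vanishing: "lin_closed W \<Longrightarrow> lin_closed (vanishing W T)"
  by (auto simp: lin_closed_def vanishing_def)

lemma vanishing_vanishing: "vanishing (vanishing W A) B = vanishing W (A \<union> B)"
  by (auto simp: vanishing_def)

lemma vanishing_mono: "W \<subseteq> W' \<Longrightarrow> vanishing W T \<subseteq> vanishing W' T"
  by (auto simp: vanishing_def)

lemma dim_le_subset: "dim_le m W \<Longrightarrow> W' \<subseteq> W \<Longrightarrow> dim_le m W'"
proof (induction m arbitrary: W W')
  case 0 then show ?case by auto
next
  case (Suc m)
  show ?case unfolding dim_le.simps
  proof (intro allI impI)
    fix s assume "\<exists>w\<in>W'. w s \<noteq> 0"
    with Suc.prems have "dim_le m (vanishing W {s})" by auto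
    then show "dim_le m (vanishing W' {s})"
      by (rule Suc.IH) (rule vanishing_mono[OF Suc.prems(2)])
  qed
qed

text \<open>Gaussian elimination: a generator \<open>g j\<close> with
  \<open>g j s \<noteq> 0\<close> is subtracted from the others so that they vanish at
  \<open>s\<close>. The condition \<open>w s = 0\<close> then fixes \<open>c j\<close>, and the
  remaining generators span everything that vanishes at \<open>s\<close>.\<close>

lemma dim_le_span:
  fixes g :: "'i \<Rightarrow> 'p \<Rightarrow> real"
  assumes "finite I" "card I = m"
  shows "dim_le m {w. \<exists>c. w = (\<lambda>p. \<Sum>i\<in>I. c i * g i p)}"
  using assms
proof (induction m arbitrary: I g)
  case 0 then show ?case by auto
next
  case (Suc m)
  show ?case unfolding dim_le.simps
  proof (intro allI impI)
    fix s assume "\<exists>w\<in>{w. \<exists>c. w = (\<lambda>p. \<Sum>i\<in>I. c i * g i p)}. w s \<noteq> 0"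
    then obtain c where "(\<Sum>i\<in>I. c i * g i s) \<noteq> 0" by auto
    then obtain j where j: "j \<in> I" "g j s \<noteq> 0"
      by (metis (no_types, lifting) mult_zero_right sum.neutral)
    let ?I = "I - {j}"
    let ?g = "\<lambda>i p. g i p - g i s / g j s * g j p"
    have "vanishing {w. \<exists>c. w = (\<lambda>p. \<Sum>i\<in>I. c i * g i p)} {s}
      \<subseteq> {w. \<exists>c. w = (\<lambda>p. \<Sum>i\<in>?I. c i * ?g i p)}"
    proof
      fix w assume "w \<in> vanishing {w. \<exists>c. w = (\<lambda>p. \<Sum>i\<in>I. c i * g i p)} {s}"
      then obtain c where w: "w = (\<lambda>p. \<Sum>i\<in>I. c i * g i p)" and ws: "w s = 0"
        by (auto simp: vanishing_def)
      have split: "w p = c j * g j p + (\<Sum>i\<in>?I. c i * g i p)" for p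
        unfolding w using j(1) Suc.prems(1) by (simp add: sum.remove)
      have "c j = - (\<Sum>i\<in>?I. c i * g i s) / g j s"
        using split[of s] ws j(2) by (simp add: field_simps)
      then have "w p = (\<Sum>i\<in>?I. c i * ?g i p)" for p
        unfolding split[of p]
        by (simp add: right_diff_distrib sum_subtractf sum_distrib_left sum_distrib_right
            sum_divide_distrib sum_negf mult_ac)
      then show "w \<in> {w. \<exists>c. w = (\<lambda>p. \<Sum>i\<in>?I. c i * ?g i p)}" by blast
    qed
    moreover have "dim_le m {w. \<exists>c. w = (\<lambda>p. \<Sum>i\<in>?I. c i * ?g i p)}"
      using Suc.prems j(1) by (intro Suc.IH) auto
    ultimately show "dim_le m (vanishing {w. \<exists>c. w = (\<lambda>p. \<Sum>i\<in>I. c i * g i p)} {s})"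
      using dim_le_subset by blast
  qed
qed

text \<open>Greedy choice: as long as some element is nonzero at some point of \<open>X\<close>,
  adding that point lowers the dimension, so at most \<open>m\<close> points are taken.\<close>

lemma vanishing_basis:
  assumes "dim_le m W"
  shows "\<exists>T. set T \<subseteq> X \<and> length T \<le> m \<and> vanishing W (set T) = vanishing W X"
  using assms
proof (induction m arbitrary: W)
  case 0
  then show ?case by (intro exI[of _ "[]"]) (auto simp: vanishing_def)
next
  case (Suc m)
  show ?case
  proof (cases "\<exists>s\<in>X. \<exists>w\<in>W. w s \<noteq> 0")
    case False
    then show ?thesis by (intro exI[of _ "[]"]) (auto simp: vanishing_def)
  next
    case True
    then obtain s w where s: "s \<in> X" "w \<in> W" "w s \<noteq> 0" by blast
    with Suc.prems have "dim_le m (vanishing W {s})" by auto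
    from Suc.IH[OF this] obtain T where T: "set T \<subseteq> X" "length T \<le> m"
      "vanishing (vanishing W {s}) (set T) = vanishing (vanishing W {s}) X" by blast
    then show ?thesis using s(1)
      by (intro exI[of _ "s # T"]) (simp add: vanishing_vanishing insert_absorb)
  qed
qed

section \<open>Counting the cells of a central hyperplane arrangement\<close>

text \<open>A new point \<open>s\<close> adds as many patterns as there are old ones realised on
  both sides of \<open>w s = 0\<close>, and these live in a space of dimension one less. With n the
  size of \<open>S\<close> and k = m - 1, the bound follows from (n+1)^m + (n+1)^k = (n+2) (n+1)^k
  \<le> (n+2)^m.\<close>

lemma card_sign_patterns:
  assumes "finite S" "lin_closed W" "dim_le m W"
  shows "card {{s\<in>S. w s \<ge> 0} | w. w \<in> W} \<le> (card S + 1) ^ m"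
  using assms
proof (induction S arbitrary: m W rule: finite_induct)
  case empty
  have "{{s\<in>{}. w s \<ge> 0} | w. w \<in> W} \<subseteq> {{}}" by auto
  from card_mono[OF _ this] show ?case by simp
next
  case (insert s S)
  define pat where "pat V = {{s\<in>S. w s \<ge> 0} | w. w \<in> V}" for V :: "('a \<Rightarrow> real) set"
  define A where "A = {{s\<in>S. w s \<ge> 0} | w. w \<in> W \<and> w s < 0}"
  define B where "B = {{s\<in>S. w s \<ge> 0} | w. w \<in> W \<and> w s \<ge> 0}"
  have fin: "finite (pat V)" for V
    by (rule finite_subset[of _ "Pow S"]) (auto simp: pat_def insert.hyps)
  have AB: "A \<union> B \<subseteq> pat W" by (auto simp: A_def B_def pat_def)
  have finAB: "finite A" "finite B" using AB fin[of W] finite_subset by blast+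
  have sub: "{{t\<in>insert s S. w t \<ge> 0} | w. w \<in> W} \<subseteq> A \<union> insert s ` B"
  proof safe
    fix w assume w: "w \<in> W" "{t \<in> insert s S. 0 \<le> w t} \<notin> insert s ` B"
    show "{t \<in> insert s S. 0 \<le> w t} \<in> A"
    proof (cases "w s \<ge> 0")
      case True
      then have "{t \<in> insert s S. 0 \<le> w t} = insert s {t\<in>S. w t \<ge> 0}" by auto
      with w True show ?thesis unfolding B_def by blast
    next
      case False
      then have "{t \<in> insert s S. 0 \<le> w t} = {t\<in>S. w t \<ge> 0}" by auto
      with w False show ?thesis unfolding A_def by force
    qed
  qed
  \<comment> \<open>A pattern on \<open>S\<close> that extends to \<open>s\<close> in both ways is also realised with \<open>w s = 0\<close>, by convexity.\<close>
  have "card {{t\<in>insert s S. w t \<ge> 0} | w. w \<in> W} \<le> card (A \<union> insert s ` B)"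
    using sub finAB by (intro card_mono) auto
  also have "\<dots> \<le> card A + card B"
    by (meson card_Un_le card_image_le finAB(2) le_trans add_left_mono)
  also have "\<dots> = card (A \<union> B) + card (A \<inter> B)" using card_Un_Int[OF finAB] .
  also have "\<dots> \<le> (card (insert s S) + 1) ^ m"
  proof (cases "A \<inter> B = {}")
    case True
    have "card (A \<union> B) \<le> card (pat W)" by (rule card_mono[OF fin AB])
    also have "\<dots> \<le> (card S + 1) ^ m"
      unfolding pat_def by (rule insert.IH[OF insert.prems])
    also have "\<dots> \<le> (card (insert s S) + 1) ^ m"
      using insert.hyps by (intro power_mono) auto
    finally show ?thesis using True by simp
  next
    case False
    then obtain u where u: "u \<in> W" "u s < 0" unfolding A_def by blast
    obtain k where k: "m = Suc k"
      using u insert.prems(2) by (cases m) auto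
    have dk: "dim_le k (vanishing W {s})" using u insert.prems(2) unfolding k by force
    have "A \<inter> B \<subseteq> pat (vanishing W {s})"
    proof
      fix P assume "P \<in> A \<inter> B"
      then obtain w w' where w: "w \<in> W" "w s < 0" "P = {t\<in>S. w t \<ge> 0}"
        and w': "w' \<in> W" "w' s \<ge> 0" "P = {t\<in>S. w' t \<ge> 0}"
        unfolding A_def B_def by blast
      have iff: "(w t \<ge> 0) = (t \<in> P)" "(w' t \<ge> 0) = (t \<in> P)" if "t \<in> S" for t
        using that by (simp add: w(3), simp add: w'(3))
      have "P \<subseteq> S" unfolding w(3) by blast
      \<comment> \<open>The weights cancel the values at \<open>s\<close>. The weight of
        \<open>w\<close> may be 0, but that of \<open>w'\<close> is strictly positive, so points
        outside \<open>P\<close> keep a strictly negative value.\<close>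
      define z where "z = (\<lambda>p. w' s * w p + (- w s) * w' p)"
      have "z \<in> W" unfolding z_def by (rule lin_closedD[OF insert.prems(1) w(1) w'(1)])
      moreover have "z s = 0" by (simp add: z_def)
      moreover have "(z t \<ge> 0) = (t \<in> P)" if t: "t \<in> S" for t
      proof (cases "t \<in> P")
        case True
        then have "w t \<ge> 0" "w' t \<ge> 0" using iff[OF t] by auto
        then have "w' s * w t \<ge> 0" "(- w s) * w' t \<ge> 0"
          using w(2) w'(2) by (auto intro: mult_nonneg_nonneg simp: mult_nonpos_nonneg)
        then show ?thesis using True by (simp add: z_def)
      next
        case F: False
        then have "w t < 0" "w' t < 0" using iff[OF t] by auto
        then have "w' s * w t \<le> 0" "(- w s) * w' t < 0"
          using w(2) w'(2) by (auto simp: mult_nonneg_nonpos mult_pos_neg mult_neg_neg)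
        then show ?thesis using F by (simp add: z_def)
      qed
      then have "P = {t\<in>S. z t \<ge> 0}" using \<open>P \<subseteq> S\<close> by auto
      ultimately show "P \<in> pat (vanishing W {s})" unfolding pat_def vanishing_def by blast
    qed
    then have "card (A \<inter> B) \<le> card (pat (vanishing W {s}))" by (rule card_mono[OF fin])
    also have "\<dots> \<le> (card S + 1) ^ k"
      unfolding pat_def by (rule insert.IH[OF lin_closed_vanishing[OF insert.prems(1)] dk])
    finally have 1: "card (A \<inter> B) \<le> (card S + 1) ^ k" .
    have "card (A \<union> B) \<le> card (pat W)" by (rule card_mono[OF fin AB])
    also have "\<dots> \<le> (card S + 1) ^ m"
      unfolding pat_def by (rule insert.IH[OF insert.prems])
    finally have "card (A \<union> B) + card (A \<inter> B) \<le> (card S + 2) * (card S + 1) ^ k"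
      using 1 by (simp add: k)
    also have "\<dots> \<le> (card S + 2) * (card S + 2) ^ k"
      by (intro mult_left_mono power_mono) auto
    finally show ?thesis using insert.hyps by (simp add: k)
  qed
  finally show ?case .
qed

section \<open>Faces of cones and extreme rays\<close>

text \<open>Moving from \<open>h\<close> in direction \<open>-v\<close> can spoil a sign only at
  points with \<open>v s \<noteq> 0\<close> and \<open>h s * v s \<ge> 0\<close>. Stopping at the
  smallest ratio \<open>h s / v s\<close> among them preserves all signs; \<open>s0\<close> ensures
  that there is one. The ratio may be 0, so \<open>t = 0\<close> can occur.\<close>

lemma ray_shoot:
  fixes h v :: "'p \<Rightarrow> real"
  assumes "finite S" "s0 \<in> S" "v s0 \<noteq> 0" "h s0 * v s0 \<ge> 0"
  obtains t s where "t \<ge> 0" "s \<in> S" "v s \<noteq> 0" "h s = t * v s"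
    "\<And>s. s \<in> S \<Longrightarrow> h s \<ge> 0 \<Longrightarrow> h s - t * v s \<ge> 0"
    "\<And>s. s \<in> S \<Longrightarrow> h s \<le> 0 \<Longrightarrow> h s - t * v s \<le> 0"
proof -
  define A where "A = {s\<in>S. v s \<noteq> 0 \<and> h s * v s \<ge> 0}"
  have A: "finite A" "A \<noteq> {}" using assms by (auto simp: A_def)
  define t where "t = Min ((\<lambda>s. h s / v s) ` A)"
  have "t \<in> (\<lambda>s. h s / v s) ` A" unfolding t_def using A by (intro Min_in) auto
  then obtain s where s: "s \<in> A" "t = h s / v s" by blast
  have t0: "t \<ge> 0" using s by (auto simp: A_def zero_le_divide_iff zero_le_mult_iff)
  have le: "t \<le> h s / v s" if "s \<in> A" for s
    unfolding t_def using A that by (intro Min_le) auto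
  have key: "(h s \<ge> 0 \<longrightarrow> h s - t * v s \<ge> 0) \<and> (h s \<le> 0 \<longrightarrow> h s - t * v s \<le> 0)" if "s \<in> S" for s
  proof (cases "s \<in> A")
    case True
    then have vs: "v s \<noteq> 0" "h s * v s \<ge> 0" by (auto simp: A_def)
    show ?thesis
    proof (cases "v s > 0")
      case True
      then have "h s \<ge> 0" using vs by (simp add: zero_le_mult_iff)
      moreover have "t * v s \<le> h s" using le[OF \<open>s \<in> A\<close>] True by (simp add: field_simps)
      ultimately show ?thesis using t0 True by auto
    next
      case False
      then have v: "v s < 0" using vs by simp
      then have "h s \<le> 0" using vs by (auto simp: zero_le_mult_iff)
      moreover have "t * v s \<ge> h s" using le[OF \<open>s \<in> A\<close>] v by (simp add: field_simps)
      ultimately show ?thesis using t0 v by (auto simp: mult_nonneg_nonpos2 mult_nonneg_nonpos)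
    qed
  next
    case False
    then have "v s = 0 \<or> h s * v s < 0" using that by (auto simp: A_def)
    then consider "v s = 0" | "h s > 0" "v s < 0" | "h s < 0" "v s > 0"
      by (auto simp: mult_less_0_iff)
    then show ?thesis
    proof cases
      case 2
      then have "t * v s \<le> 0" using t0 by (simp add: mult_nonneg_nonpos)
      with 2 show ?thesis by simp
    next
      case 3
      then have "t * v s \<ge> 0" using t0 by simp
      with 3 show ?thesis by simp
    qed auto
  qed
  show ?thesis using s t0 key by (intro that[of t s]) (auto simp: A_def)
qed

text \<open>A closed cell of the arrangement of hyperplanes \<open>w s = 0\<close>, cut down to a
  face by \<open>Z\<close>. Weak inequalities keep a vector in the cell when it reaches a
  facet.\<close>

definition cone :: "('p \<Rightarrow> real) set \<Rightarrow> 'p set \<Rightarrow> 'p set \<Rightarrow> 'p set \<Rightarrow> ('p \<Rightarrow> real) set" where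
  "cone W S \<sigma> Z = {w \<in> vanishing W Z. \<forall>s\<in>S. (s \<in> \<sigma> \<longrightarrow> w s \<ge> 0) \<and> (s \<notin> \<sigma> \<longrightarrow> w s \<le> 0)}"

text \<open>Such a \<open>v\<close> spans a one-dimensional flat of the arrangement. The flat is
  given by a short list of sample points, so that rays can be enumerated by tuples independently of
  any cell.\<close>

definition extremal :: "('p \<Rightarrow> real) set \<Rightarrow> 'p set \<Rightarrow> nat \<Rightarrow> ('p \<Rightarrow> real) \<Rightarrow> bool" where
  "extremal W S m v \<longleftrightarrow> (\<exists>p. v p \<noteq> 0) \<and>
     (\<exists>T. set T \<subseteq> S \<and> length T \<le> m \<and> v \<in> vanishing W (set T) \<and>
       (\<forall>w\<in>vanishing W (set T). \<exists>c. \<forall>p. w p = c * v p))"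

text \<open>A nonzero element of the face with minimal support on \<open>S\<close> is extremal.\<close>

lemma extremal_exists:
  assumes W: "lin_closed W" "dim_le m W" and S: "finite S"
    and sep: "\<forall>w\<in>W. (\<forall>s\<in>S. w s = 0) \<longrightarrow> (\<forall>p. w p = 0)"
    and Z: "Z \<subseteq> S" and w: "w \<in> cone W S \<sigma> Z" "\<exists>p. w p \<noteq> 0"
  shows "\<exists>v \<in> cone W S \<sigma> Z. extremal W S m v"
proof -
  let ?P = "\<lambda>v. v \<in> cone W S \<sigma> Z \<and> (\<exists>p. v p \<noteq> 0)"
  let ?f = "\<lambda>v. card {s\<in>S. v s \<noteq> 0}"
  define v where "v = arg_min ?f ?P"
  have v: "?P v" and vmin: "\<And>u. ?P u \<Longrightarrow> ?f v \<le> ?f u"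
    using arg_min_nat_lemma[of ?P w ?f] w unfolding v_def by blast+
  then have vW: "v \<in> W" by (auto simp: cone_def vanishing_def)
  define T0 where "T0 = {s\<in>S. v s = 0}"
  have mult: "\<exists>c. \<forall>p. u p = c * v p" if u: "u \<in> vanishing W T0" for u
  proof (rule ccontr)
    \<comment> \<open>Since \<open>u\<close> vanishes on \<open>S\<close> wherever \<open>v\<close>
      does, \<open>v\<close> can be moved along \<open>u\<close>, oriented by \<open>e\<close>,
      until one more coordinate vanishes. The result \<open>x\<close> stays in the face and is
      nonzero because \<open>u\<close> is no multiple of \<open>v\<close>, so its smaller support
      contradicts minimality.\<close>
    assume non: "\<nexists>c. \<forall>p. u p = c * v p"
    have uW: "u \<in> W" and uz: "\<And>s. s \<in> S \<Longrightarrow> v s = 0 \<Longrightarrow> u s = 0"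
      using u by (auto simp: vanishing_def T0_def)
    have "\<not> (\<forall>s\<in>S. u s = 0)"
      using sep uW non by (metis mult_zero_left)
    then obtain s0 where s0: "s0 \<in> S" "u s0 \<noteq> 0" by blast
    obtain e :: real where e: "e \<noteq> 0" "v s0 * (e * u s0) \<ge> 0"
    proof (cases "v s0 * u s0 \<ge> 0")
      case True then show ?thesis by (intro that[of 1]) auto
    next
      case False then show ?thesis by (intro that[of "-1"]) auto
    qed
    define y where "y = (\<lambda>p. e * u p)"
    obtain t s where t: "t \<ge> 0" "s \<in> S" "y s \<noteq> 0" "v s = t * y s"
      "\<And>s. s \<in> S \<Longrightarrow> v s \<ge> 0 \<Longrightarrow> v s - t * y s \<ge> 0"
      "\<And>s. s \<in> S \<Longrightarrow> v s \<le> 0 \<Longrightarrow> v s - t * y s \<le> 0"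
      using ray_shoot[of S s0 y v] S s0 e unfolding y_def by (metis mult_eq_0_iff)
    define x where "x = (\<lambda>p. v p - t * e * u p)"
    have xW: "x \<in> W" unfolding x_def by (rule lin_closed_diff[OF W(1) vW uW])
    have xs: "v s \<ge> 0 \<Longrightarrow> x s \<ge> 0" "v s \<le> 0 \<Longrightarrow> x s \<le> 0" if "s \<in> S" for s
      using t(5,6)[OF that] by (auto simp: x_def y_def mult_ac)
    have "x \<in> cone W S \<sigma> Z"
      using v xW xs Z by (force simp: cone_def vanishing_def intro: order_antisym)
    moreover have "\<exists>p. x p \<noteq> 0"
    proof (rule ccontr)
      assume "\<nexists>p. x p \<noteq> 0"
      then have 0: "v p = t * e * u p" for p by (simp add: x_def)
      then have "t * e \<noteq> 0" using v by force
      then have "\<forall>p. u p = (1 / (t * e)) * v p" using 0 by simp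
      then show False using non by blast
    qed
    ultimately have "?f v \<le> ?f x" by (intro vmin) blast
    moreover have "{s\<in>S. x s \<noteq> 0} \<subset> {s\<in>S. v s \<noteq> 0}"
    proof -
      have "{s\<in>S. x s \<noteq> 0} \<subseteq> {s\<in>S. v s \<noteq> 0}" using xs by force
      moreover have "v s \<noteq> 0" using uz[OF t(2)] t(3) by (auto simp: y_def)
      moreover have "x s = 0" using t(4) by (simp add: x_def y_def)
      ultimately show ?thesis using t(2) by blast
    qed
    then have "?f x < ?f v" using S by (intro psubset_card_mono) auto
    ultimately show False by simp
  qed
  \<comment> \<open>Reduces the set of all zeros of \<open>v\<close> in \<open>S\<close> to at most
    \<open>m\<close> points defining the same flat.\<close>
  obtain T where T: "set T \<subseteq> T0" "length T \<le> m" "vanishing W (set T) = vanishing W T0"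
    using vanishing_basis[OF W(2)] by blast
  have "v \<in> vanishing W T0" using vW by (auto simp: vanishing_def T0_def)
  then have "extremal W S m v"
    unfolding extremal_def using v T mult by (metis (no_types, lifting) T0_def mem_Collect_eq subset_iff)
  then show ?thesis using v by blast
qed

section \<open>Decomposition of a vector along a flag of faces\<close>

text \<open>The rays are peeled off in the order in which the flag of faces produces them. The
  coefficients are strictly positive, which makes \<open>pos_comb_pos\<close> true.\<close>

primrec pos_comb :: "('p \<Rightarrow> real) list \<Rightarrow> ('p \<Rightarrow> real) \<Rightarrow> bool" where
  "pos_comb [] h \<longleftrightarrow> (\<forall>p. h p = 0)"
| "pos_comb (v # vs) h \<longleftrightarrow> (\<exists>t>0. pos_comb vs (\<lambda>p. h p - t * v p))"

lemma pos_comb_nonpos: "pos_comb vs h \<Longrightarrow> \<forall>v\<in>set vs. v p \<le> 0 \<Longrightarrow> h p \<le> 0"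
proof (induction vs arbitrary: h)
  case (Cons v vs)
  then obtain t where t: "t > 0" "pos_comb vs (\<lambda>p. h p - t * v p)" by auto
  have "h p - t * v p \<le> 0" using Cons.IH[OF t(2)] Cons.prems(2) by simp
  moreover have "t * v p \<le> 0" using t Cons.prems by (simp add: mult_nonneg_nonpos)
  ultimately show ?case by simp
qed simp

lemma pos_comb_nonneg: "pos_comb vs h \<Longrightarrow> \<forall>v\<in>set vs. v p \<ge> 0 \<Longrightarrow> h p \<ge> 0"
proof (induction vs arbitrary: h)
  case (Cons v vs)
  then obtain t where t: "t > 0" "pos_comb vs (\<lambda>p. h p - t * v p)" by auto
  have "h p - t * v p \<ge> 0" using Cons.IH[OF t(2)] Cons.prems(2) by simp
  moreover have "t * v p \<ge> 0" using t Cons.prems by simp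
  ultimately show ?case by simp
qed simp

lemma pos_comb_pos:
  "pos_comb vs h \<Longrightarrow> \<forall>v\<in>set vs. v p \<ge> 0 \<Longrightarrow> \<exists>v\<in>set vs. v p > 0 \<Longrightarrow> h p > 0"
proof (induction vs arbitrary: h)
  case (Cons v vs)
  then obtain t where t: "t > 0" "pos_comb vs (\<lambda>p. h p - t * v p)" by auto
  have 1: "h p - t * v p \<ge> 0" using pos_comb_nonneg[OF t(2)] Cons.prems by auto
  have 2: "t * v p \<ge> 0" using t Cons.prems by simp
  show ?case
  proof (cases "v p > 0")
    case True
    then have "t * v p > 0" using t by simp
    then show ?thesis using 1 by simp
  next
    case False
    then have "h p - t * v p > 0" using Cons.IH[OF t(2)] Cons.prems(2,3) by simp
    then show ?thesis using 2 by simp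
  qed
qed simp

text \<open>
  The flag \<open>b\<close> records whether the ray picked in the current face occurs with a positive
  coefficient. A ray with coefficient \<open>0\<close> must be left out, since it need not vanish at a point
  where \<open>h\<close> does.
\<close>

fun flag_rays :: "('p set \<Rightarrow> 'p \<Rightarrow> real) \<Rightarrow> 'p set \<Rightarrow> ('p \<times> bool) list \<Rightarrow> ('p \<Rightarrow> real) list" where
  "flag_rays pick Z [] = []"
| "flag_rays pick Z ((s, b) # cs) = (if b then [pick Z] else []) @ flag_rays pick (insert s Z) cs"

lemma length_flag_rays: "length (flag_rays pick Z cs) \<le> length cs"
  by (induction pick Z cs rule: flag_rays.induct) auto

text \<open>Induction on the dimension of the face: \<open>pick Z\<close> lies in the face and is
  nonzero at the point \<open>s\<close> that is hit, so passing to \<open>insert s Z\<close> lowers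
  the dimension. Only \<open>cs\<close> depends on \<open>h\<close>; the rays are determined by
  \<open>pick\<close> and \<open>cs\<close>, so counting codes counts ray lists.\<close>

lemma flag_decomposition:
  assumes W: "lin_closed W" and S: "finite S"
    and sep: "\<forall>w\<in>W. (\<forall>s\<in>S. w s = 0) \<longrightarrow> (\<forall>p. w p = 0)"
    and pick: "\<forall>Z w. Z \<subseteq> S \<longrightarrow> w \<in> cone W S \<sigma> Z \<longrightarrow> (\<exists>p. w p \<noteq> 0) \<longrightarrow>
      pick Z \<in> cone W S \<sigma> Z \<and> extremal W S m (pick Z)"
  shows "dim_le k (vanishing W Z) \<Longrightarrow> Z \<subseteq> S \<Longrightarrow> h \<in> cone W S \<sigma> Z \<Longrightarrow>
    \<exists>cs. length cs \<le> k \<and> set cs \<subseteq> S \<times> UNIV \<and> pos_comb (flag_rays pick Z cs) h \<and>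
      (\<forall>v\<in>set (flag_rays pick Z cs). v \<in> cone W S \<sigma> {} \<and> extremal W S m v)"
proof (induction k arbitrary: Z h)
  case 0
  then have "\<forall>p. h p = 0" by (auto simp: cone_def)
  then show ?case by (intro exI[of _ "[]"]) auto
next
  case (Suc k)
  show ?case
  proof (cases "\<forall>p. h p = 0")
    case True
    then show ?thesis by (intro exI[of _ "[]"]) auto
  next
    case False
    then have v: "pick Z \<in> cone W S \<sigma> Z" "extremal W S m (pick Z)"
      using pick Suc.prems(2,3) by blast+
    define v where "v = pick Z"
    have vV: "v \<in> vanishing W Z" and hV: "h \<in> vanishing W Z"
      using v Suc.prems by (auto simp: cone_def v_def)
    have sgn: "h s * v s \<ge> 0" if "s \<in> S" for s
      using that v(1) Suc.prems(3) unfolding v_def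
      by (cases "s \<in> \<sigma>") (auto simp: cone_def mult_nonpos_nonpos)
    obtain s0 where s0: "s0 \<in> S" "v s0 \<noteq> 0"
      using v sep unfolding v_def extremal_def cone_def vanishing_def by blast
    obtain t s where t: "t \<ge> 0" "s \<in> S" "v s \<noteq> 0" "h s = t * v s"
      "\<And>s. s \<in> S \<Longrightarrow> h s \<ge> 0 \<Longrightarrow> h s - t * v s \<ge> 0"
      "\<And>s. s \<in> S \<Longrightarrow> h s \<le> 0 \<Longrightarrow> h s - t * v s \<le> 0"
      using ray_shoot[of S s0 v h] S s0 sgn[OF s0(1)] by metis
    define g where "g = (\<lambda>p. h p - t * v p)"
    have "g \<in> vanishing W Z"
      unfolding g_def by (rule lin_closed_diff[OF lin_closed_vanishing[OF W] hV vV])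
    moreover have "g s = 0" using t(4) by (simp add: g_def)
    ultimately have "g \<in> cone W S \<sigma> (insert s Z)"
      using t(5,6) Suc.prems(3) by (auto simp: cone_def vanishing_def g_def)
    moreover have "dim_le k (vanishing W (insert s Z))"
    proof -
      have "dim_le k (vanishing (vanishing W Z) {s})"
        using Suc.prems(1) vV t(3) by auto
      then show ?thesis by (simp add: vanishing_vanishing)
    qed
    ultimately obtain cs where cs: "length cs \<le> k" "set cs \<subseteq> S \<times> UNIV"
      "pos_comb (flag_rays pick (insert s Z) cs) g"
      "\<forall>v\<in>set (flag_rays pick (insert s Z) cs). v \<in> cone W S \<sigma> {} \<and> extremal W S m v"
      using Suc.IH[of "insert s Z" g] Suc.prems(2) t(2) by auto
    have "v \<in> cone W S \<sigma> {}" using v(1) by (auto simp: cone_def vanishing_def v_def)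
    moreover have "pos_comb (flag_rays pick Z ((s, t > 0) # cs)) h"
    proof (cases "t > 0")
      case True
      then show ?thesis using cs(3) by (auto simp: g_def v_def)
    next
      case False
      then have "g = h" using t(1) by (simp add: g_def)
      then show ?thesis using cs(3) False by simp
    qed
    ultimately show ?thesis
      using cs t(2) v(2) by (intro exI[of _ "(s, t > 0) # cs"]) (auto simp: v_def)
  qed
qed

section \<open>Random samples that hit all large regions\<close>

text \<open>
  \<open>R i x\<close> depends only on the at most \<open>D\<close> sample points \<open>x k\<close> with \<open>k \<in> J i\<close>; the others avoid a large
  \<open>R i x\<close> independently. Counting all samples \<open>x\<close> replaces the probability measure.
\<close>

lemma local_net:
  fixes R :: "'i \<Rightarrow> (nat \<Rightarrow> 'p) \<Rightarrow> 'p set"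
  assumes U: "finite U" "U \<noteq> {}" and I: "finite I"
    and J: "\<And>i. i \<in> I \<Longrightarrow> J i \<subseteq> {..<r}" "\<And>i. i \<in> I \<Longrightarrow> card (J i) \<le> D"
    and local: "\<And>i x y. i \<in> I \<Longrightarrow> (\<forall>k\<in>J i. x k = y k) \<Longrightarrow> R i x = R i y"
    and \<epsilon>: "0 \<le> \<epsilon>" "\<epsilon> \<le> 1" and small: "real (card I) * (1 - \<epsilon>) ^ (r - D) < 1"
  shows "\<exists>x \<in> {..<r} \<rightarrow>\<^sub>E U. \<forall>i\<in>I. R i x \<inter> x ` {..<r} = {} \<longrightarrow>
           real (card (R i x \<inter> U)) \<le> \<epsilon> * real (card U)"
proof -
  define n where "n = real (card U)"
  have n: "n > 0" using U by (simp add: n_def card_gt_0_iff)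
  let ?X = "{..<r} \<rightarrow>\<^sub>E U"
  define Bad where "Bad i = {x \<in> ?X. R i x \<inter> x ` {..<r} = {} \<and> \<epsilon> * n < real (card (R i x \<inter> U))}" for i
  have finX: "finite ?X" using U by (intro finite_PiE) auto
  have cardX: "real (card ?X) = n ^ r" by (simp add: card_PiE n_def)
  have bad: "real (card (Bad i)) \<le> n ^ r * (1 - \<epsilon>) ^ (r - D)" if i: "i \<in> I" for i
  proof -
    define K where "K = {..<r} - J i"
    have finJ: "finite (J i)" using J(1)[OF i] finite_subset by blast
    have cK: "card K = r - card (J i)" "card (J i) \<le> r"
      using J(1)[OF i] finJ card_mono[OF _ J(1)[OF i]] by (auto simp: K_def card_Diff_subset)
    define Y where "Y = {y \<in> J i \<rightarrow>\<^sub>E U. \<epsilon> * n < real (card (R i y \<inter> U))}"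
    have finY: "finite Y" unfolding Y_def using U finJ by (simp add: finite_PiE)
    \<comment> \<open>A bad sample splits into its coordinates in \<open>J i\<close>, which already
      fix the region, and those in \<open>K\<close>, each confined to the at most (1 - \<epsilon>) n
      points outside the region.\<close>
    let ?f = "\<lambda>x. (restrict x (J i), restrict x K)"
    have inj: "inj_on ?f (Bad i)"
    proof (rule inj_onI)
      fix x y assume xy: "x \<in> Bad i" "y \<in> Bad i" "?f x = ?f y"
      have "x k = y k" for k
      proof (cases "k \<in> {..<r}")
        case True
        then have "k \<in> J i \<or> k \<in> K" by (auto simp: K_def)
        then show ?thesis using xy(3) by (metis prod.inject restrict_apply')
      next
        case False
        then show ?thesis using xy by (metis (mono_tags, lifting) Bad_def PiE_arb mem_Collect_eq)
      qed
      then show "x = y" by blast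
    qed
    have img: "?f ` Bad i \<subseteq> (SIGMA y:Y. K \<rightarrow>\<^sub>E (U - R i y))"
    proof (rule image_subsetI)
      fix x assume x: "x \<in> Bad i"
      have R: "R i (restrict x (J i)) = R i x" by (rule local[OF i]) auto
      have "x k \<in> U" if "k < r" for k using x that by (auto simp: Bad_def)
      moreover have "x k \<notin> R i x" if "k < r" for k using x that by (auto simp: Bad_def)
      ultimately show "?f x \<in> (SIGMA y:Y. K \<rightarrow>\<^sub>E (U - R i y))"
        using x J(1)[OF i] R by (auto simp: Y_def Bad_def K_def)
    qed
    have finS: "finite (SIGMA y:Y. K \<rightarrow>\<^sub>E (U - R i y))"
      using finY U by (intro finite_SigmaI finite_PiE) (auto simp: K_def)
    have "card (Bad i) \<le> card (SIGMA y:Y. K \<rightarrow>\<^sub>E (U - R i y))"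
      using card_inj_on_le[OF inj img finS] .
    also have "\<dots> = (\<Sum>y\<in>Y. card (U - R i y) ^ card K)"
      using finY U by (subst card_SigmaI) (auto simp: K_def card_PiE intro!: finite_PiE)
    finally have "real (card (Bad i)) \<le> (\<Sum>y\<in>Y. real (card (U - R i y)) ^ card K)"
      by (metis (mono_tags, lifting) of_nat_le_iff of_nat_power of_nat_sum sum.cong)
    also have "\<dots> \<le> (\<Sum>y\<in>Y. ((1 - \<epsilon>) * n) ^ card K)"
    proof (intro sum_mono power_mono)
      fix y assume "y \<in> Y"
      then have 1: "\<epsilon> * n < real (card (R i y \<inter> U))" by (simp add: Y_def)
      have "card U = card (R i y \<inter> U) + card (U - R i y)"
        using U by (metis Int_commute add.commute card_Diff_subset_Int card_mono finite_Int
            inf_le1 le_add_diff_inverse2)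
      then show "real (card (U - R i y)) \<le> (1 - \<epsilon>) * n"
        using 1 by (simp add: n_def algebra_simps)
    qed auto
    also have "\<dots> = real (card Y) * ((1 - \<epsilon>) * n) ^ card K" by simp
    also have "\<dots> \<le> n ^ card (J i) * ((1 - \<epsilon>) * n) ^ card K"
    proof (intro mult_right_mono)
      have "card Y \<le> card (J i \<rightarrow>\<^sub>E U)"
        unfolding Y_def using U finJ by (intro card_mono finite_PiE) auto
      also have "\<dots> = card U ^ card (J i)" using finJ by (simp add: card_PiE)
      finally show "real (card Y) \<le> n ^ card (J i)" unfolding n_def
        by (metis of_nat_le_iff of_nat_power)
      show "0 \<le> ((1 - \<epsilon>) * n) ^ card K" using \<epsilon> n by simp
    qed
    also have "\<dots> = n ^ (card (J i) + card K) * (1 - \<epsilon>) ^ card K"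
      by (simp add: power_mult_distrib power_add)
    also have "card (J i) + card K = r" using cK by simp
    also have "n ^ r * (1 - \<epsilon>) ^ card K \<le> n ^ r * (1 - \<epsilon>) ^ (r - D)"
      using cK J(2)[OF i] \<epsilon> n by (intro mult_left_mono power_decreasing) auto
    finally show ?thesis .
  qed
  have "real (card (\<Union>i\<in>I. Bad i)) \<le> (\<Sum>i\<in>I. real (card (Bad i)))"
    using card_UN_le[OF I, of Bad] by (metis of_nat_le_iff of_nat_sum)
  also have "\<dots> \<le> (\<Sum>i\<in>I. n ^ r * (1 - \<epsilon>) ^ (r - D))" by (intro sum_mono bad)
  also have "\<dots> = n ^ r * (real (card I) * (1 - \<epsilon>) ^ (r - D))" by simp
  also have "\<dots> < n ^ r * 1" using n small by (intro mult_strict_left_mono) auto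
  finally have "card (\<Union>i\<in>I. Bad i) < card ?X" using cardX by simp
  moreover have "finite (\<Union>i\<in>I. Bad i)"
    using finX I by (auto simp: Bad_def)
  ultimately have "\<not> ?X \<subseteq> (\<Union>i\<in>I. Bad i)" using card_mono by (metis linorder_not_le)
  then obtain x where "x \<in> ?X" "\<forall>i\<in>I. x \<notin> Bad i" by blast
  then show ?thesis by (intro bexI[of _ x]) (auto simp: Bad_def n_def not_less)
qed

section \<open>Construction of the containers\<close>

lemma card_lists_le_power:
  assumes "finite A"
  shows "finite {xs. set xs \<subseteq> A \<and> length xs \<le> n}"
    and "card {xs. set xs \<subseteq> A \<and> length xs \<le> n} \<le> (card A + 1) ^ n"
proof -
  show "finite {xs. set xs \<subseteq> A \<and> length xs \<le> n}" using finite_lists_length_le[OF assms] .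
  have "(\<Sum>i\<le>n. k ^ i) \<le> (k + 1) ^ n" for k :: nat
  proof (induction n)
    case (Suc n)
    have "k ^ Suc n \<le> k * (k + 1) ^ n" by (simp add: power_mono)
    from add_mono[OF Suc this] show ?case by (simp add: sum.atMost_Suc)
  qed simp
  then show "card {xs. set xs \<subseteq> A \<and> length xs \<le> n} \<le> (card A + 1) ^ n"
    by (simp add: card_lists_length_le[OF assms])
qed

lemma container_family:
  fixes W :: "('p \<Rightarrow> real) set" and \<epsilon> :: real
  assumes W: "lin_closed W" "dim_le m W" and U: "finite U" "U \<noteq> {}"
    and supp: "\<forall>w\<in>W. \<forall>p. p \<notin> U \<longrightarrow> w p = 0"
    and m: "m > 0" and \<epsilon>: "0 < \<epsilon>" "\<epsilon> \<le> 1"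
    and r: "2 * real (r + m + 1) ^ (2 * m) * (1 - \<epsilon> / real m ^ 2) ^ (r - 2 * m) < 1"
  obtains \<C> where "\<C> \<subseteq> Pow U" "card \<C> \<le> ((r + m + 1) * (2 * (r + m) + 1)) ^ m"
    "\<And>h. h \<in> W \<Longrightarrow> \<exists>C\<in>\<C>. {p\<in>U. h p > 0} \<subseteq> C \<and>
       real (card (C - {p\<in>U. h p > 0})) \<le> \<epsilon> * real (card U)"
proof -
  define \<epsilon>' where "\<epsilon>' = \<epsilon> / real m ^ 2"
  have m2: "real m ^ 2 \<ge> 1" using m by simp
  have \<epsilon>': "0 \<le> \<epsilon>'" "\<epsilon>' \<le> 1" using \<epsilon> m2 by (auto simp: \<epsilon>'_def divide_le_eq)
  \<comment> \<open>If the flat of \<open>A\<close> is a line, this recovers its extreme ray up to a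
    nonzero scalar of unknown sign. The flag \<open>b\<close> in \<open>R\<close> compensates for
    the sign of the product of two such scalars.\<close>
  define u where "u A = (SOME w. w \<in> vanishing W (set A) \<and> (\<exists>p. w p \<noteq> 0))" for A
  define R where "R b A B = {p\<in>U. if b then u A p * u B p < 0 else u A p * u B p > 0}" for b A B
  obtain T where T: "set T \<subseteq> U" "length T \<le> m" "vanishing W (set T) = vanishing W U"
    using vanishing_basis[OF W(2)] by blast
  \<comment> \<open>\<open>T\<close> is added to the random sample to make all cones pointed.\<close>
  define q where "q = r + length T"
  define ext where "ext x i = (if i < r then x i else T ! (i - r))" for x :: "nat \<Rightarrow> 'p" and i
  \<comment> \<open>Tuples consist of indices, since the points themselves vary with the sample.
    Indices from \<open>r\<close> on denote the fixed points of \<open>T\<close>; \<open>J\<close>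
    drops them.\<close>
  define L where "L = {xs. set xs \<subseteq> {..<q} \<and> length xs \<le> m}"
  define I where "I = (UNIV :: bool set) \<times> L \<times> L"
  define J where "J i = (set (fst (snd i)) \<union> set (snd (snd i))) \<inter> {..<r}" for i :: "bool \<times> nat list \<times> nat list"
  define RR where "RR i x = R (fst i) (map (ext x) (fst (snd i))) (map (ext x) (snd (snd i)))" for i x
  have L: "finite L" "card L \<le> (q + 1) ^ m"
    unfolding L_def using card_lists_le_power[of "{..<q}" m] by auto
  have "\<exists>x \<in> {..<r} \<rightarrow>\<^sub>E U. \<forall>i\<in>I. RR i x \<inter> x ` {..<r} = {} \<longrightarrow>
           real (card (RR i x \<inter> U)) \<le> \<epsilon>' * real (card U)"
  proof (rule local_net[OF U, where J = J and D = "2 * m"])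
    show "finite I" using L by (simp add: I_def)
    fix i assume i: "i \<in> I"
    show "J i \<subseteq> {..<r}" by (simp add: J_def)
    have "card (J i) \<le> card (set (fst (snd i)) \<union> set (snd (snd i)))"
      unfolding J_def by (intro card_mono) auto
    also have "\<dots> \<le> length (fst (snd i)) + length (snd (snd i))"
      by (meson card_Un_le card_length add_mono le_trans)
    also have "\<dots> \<le> 2 * m" using i by (auto simp: I_def L_def)
    finally show "card (J i) \<le> 2 * m" .
    fix x y :: "nat \<Rightarrow> 'p" assume "\<forall>k\<in>J i. x k = y k"
    then have "ext x k = ext y k" if "k \<in> set (fst (snd i)) \<union> set (snd (snd i))" for k
      using that by (auto simp: ext_def J_def)
    then have "map (ext x) (fst (snd i)) = map (ext y) (fst (snd i))"
      "map (ext x) (snd (snd i)) = map (ext y) (snd (snd i))" by auto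
    then show "RR i x = RR i y" unfolding RR_def by (simp only:)
  next
    have "card I = 2 * card L * card L" by (simp add: I_def card_cartesian_product)
    also have "\<dots> \<le> 2 * (q + 1) ^ m * (q + 1) ^ m"
      using L by (intro mult_mono) auto
    also have "\<dots> = 2 * (q + 1) ^ (2 * m)" by (simp add: power_even_eq power2_eq_square)
    also have "\<dots> \<le> 2 * (r + m + 1) ^ (2 * m)"
      using T(2) by (intro mult_left_mono power_mono) (auto simp: q_def)
    finally have "real (card I) \<le> real (2 * (r + m + 1) ^ (2 * m))" by (simp only: of_nat_le_iff)
    then have "real (card I) \<le> 2 * real (r + m + 1) ^ (2 * m)"
      by (simp only: of_nat_mult of_nat_power of_nat_numeral)
    then have "real (card I) * (1 - \<epsilon>') ^ (r - 2 * m)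
        \<le> 2 * real (r + m + 1) ^ (2 * m) * (1 - \<epsilon>') ^ (r - 2 * m)"
      using \<epsilon>' by (intro mult_right_mono) auto
    with r show "real (card I) * (1 - \<epsilon>') ^ (r - 2 * m) < 1" by (simp add: \<epsilon>'_def)
  qed (use \<epsilon>' in auto)
  then obtain x where x: "x \<in> {..<r} \<rightarrow>\<^sub>E U" and net: "\<And>i. i \<in> I \<Longrightarrow> RR i x \<inter> x ` {..<r} = {} \<Longrightarrow>
           real (card (RR i x \<inter> U)) \<le> \<epsilon>' * real (card U)" by blast
  define S where "S = ext x ` {..<q}"
  have S: "finite S" "card S \<le> q" using card_image_le[of "{..<q}" "ext x"] by (auto simp: S_def)
  have xS: "x ` {..<r} \<subseteq> S" by (force simp: S_def ext_def q_def)
  have TS: "set T \<subseteq> S"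
  proof
    fix t assume "t \<in> set T"
    then obtain k where "k < length T" "t = T ! k" by (metis in_set_conv_nth)
    then have "t = ext x (r + k)" "r + k < q" by (auto simp: ext_def q_def)
    then show "t \<in> S" by (auto simp: S_def)
  qed
  have sep: "\<forall>w\<in>W. (\<forall>s\<in>S. w s = 0) \<longrightarrow> (\<forall>p. w p = 0)"
  proof (intro ballI impI allI)
    fix w p assume w: "w \<in> W" "\<forall>s\<in>S. w s = 0"
    then have "w \<in> vanishing W U" using TS unfolding T(3)[symmetric] by (auto simp: vanishing_def)
    then show "w p = 0" using supp w(1) by (cases "p \<in> U") (auto simp: vanishing_def)
  qed
  have netS: "real (card (R b A B)) \<le> \<epsilon>' * real (card U)"
    if AB: "set A \<subseteq> S" "length A \<le> m" "set B \<subseteq> S" "length B \<le> m" and disj: "R b A B \<inter> S = {}" for b A B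
  proof -
    have lift: "\<exists>as\<in>L. map (ext x) as = A" if "set A \<subseteq> S" "length A \<le> m" for A
    proof -
      have "A \<in> lists (ext x ` {..<q})" using that by (auto simp: S_def)
      then obtain as where "as \<in> lists {..<q}" "A = map (ext x) as"
        by (auto simp: lists_image)
      then show ?thesis using that by (auto simp: L_def)
    qed
    obtain as bs where "as \<in> L" "map (ext x) as = A" "bs \<in> L" "map (ext x) bs = B"
      using lift AB by metis
    then have "(b, as, bs) \<in> I" "RR (b, as, bs) x = R b A B" by (auto simp: I_def RR_def)
    moreover have "R b A B \<inter> U = R b A B" by (auto simp: R_def)
    moreover have "R b A B \<inter> x ` {..<r} = {}" using disj xS by blast
    ultimately show ?thesis using net[of "(b, as, bs)"] by simp
  qed
  have cross: "real (card {p\<in>U. v p * v' p < 0}) \<le> \<epsilon>' * real (card U)"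
    if v: "extremal W S m v" "extremal W S m v'" and conf: "\<forall>s\<in>S. v s * v' s \<ge> 0" for v v'
  proof -
    have u: "\<exists>A c. set A \<subseteq> S \<and> length A \<le> m \<and> c \<noteq> 0 \<and> (\<forall>p. u A p = c * v p)"
      if ext_v: "extremal W S m v" for v
    proof -
      obtain A where A: "set A \<subseteq> S" "length A \<le> m" "v \<in> vanishing W (set A)"
        "\<forall>w\<in>vanishing W (set A). \<exists>c. \<forall>p. w p = c * v p" and "\<exists>p. v p \<noteq> 0"
        using ext_v unfolding extremal_def by blast
      then have "\<exists>w. w \<in> vanishing W (set A) \<and> (\<exists>p. w p \<noteq> 0)" by blast
      then have uA: "u A \<in> vanishing W (set A) \<and> (\<exists>p. u A p \<noteq> 0)"
        unfolding u_def by (rule someI_ex)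
      then obtain c where c: "\<forall>p. u A p = c * v p" using A(4) by blast
      then have "c \<noteq> 0" using uA by auto
      then show ?thesis using A c by blast
    qed
    obtain A c where A: "set A \<subseteq> S" "length A \<le> m" "c \<noteq> 0" "\<And>p. u A p = c * v p" using u[OF v(1)] by blast
    obtain B d where B: "set B \<subseteq> S" "length B \<le> m" "d \<noteq> 0" "\<And>p. u B p = d * v' p" using u[OF v(2)] by blast
    define k where "k = c * d"
    have eq: "u A p * u B p = k * (v p * v' p)" for p by (simp add: A B k_def)
    have "k \<noteq> 0" using A B by (simp add: k_def)
    then have "{p\<in>U. v p * v' p < 0} = R (k > 0) A B"
      unfolding R_def eq by (cases "k > 0") (auto simp: mult_less_0_iff[of k] zero_less_mult_iff[of k])
    moreover have "{p\<in>U. v p * v' p < 0} \<inter> S = {}" using conf by force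
    ultimately show ?thesis using netS[OF A(1,2) B(1,2)] by simp
  qed
  \<comment> \<open>The choice depends on \<open>\<sigma>\<close> and \<open>Z\<close> but not on
    \<open>h\<close>, so a container is determined by a pair of a sign pattern and a code.\<close>
  define pick where "pick \<sigma> Z = (SOME v. v \<in> cone W S \<sigma> Z \<and> extremal W S m v)" for \<sigma> Z
  have pick: "\<forall>Z w. Z \<subseteq> S \<longrightarrow> w \<in> cone W S \<sigma> Z \<longrightarrow> (\<exists>p. w p \<noteq> 0) \<longrightarrow>
      pick \<sigma> Z \<in> cone W S \<sigma> Z \<and> extremal W S m (pick \<sigma> Z)" for \<sigma>
  proof (intro allI impI)
    fix Z w assume "Z \<subseteq> S" "w \<in> cone W S \<sigma> Z" "\<exists>p. w p \<noteq> 0"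
    from extremal_exists[OF W S(1) sep this]
    have "\<exists>v. v \<in> cone W S \<sigma> Z \<and> extremal W S m v" by blast
    then show "pick \<sigma> Z \<in> cone W S \<sigma> Z \<and> extremal W S m (pick \<sigma> Z)"
      unfolding pick_def by (rule someI_ex)
  qed
  define pos where "pos vs = {p\<in>U. \<exists>v\<in>set vs. v p > 0}" for vs :: "('p \<Rightarrow> real) list"
  define cells where "cells = {{s\<in>S. w s \<ge> 0} | w. w \<in> W}"
  define codes where "codes = {cs. set cs \<subseteq> S \<times> (UNIV :: bool set) \<and> length cs \<le> m}"
  define \<C> where "\<C> = (\<lambda>(\<sigma>, cs). pos (flag_rays (pick \<sigma>) {} cs)) ` (cells \<times> codes)"
  have fin: "finite cells" by (rule finite_subset[of _ "Pow S"]) (auto simp: cells_def S)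
  have codes: "finite codes" "card codes \<le> (card S * 2 + 1) ^ m"
    unfolding codes_def using card_lists_le_power[of "S \<times> (UNIV :: bool set)" m] S
    by (auto simp: card_cartesian_product)
  show ?thesis
  proof (rule that[of \<C>])
    show "\<C> \<subseteq> Pow U" by (auto simp: \<C>_def pos_def)
    have "card \<C> \<le> card (cells \<times> codes)"
      unfolding \<C>_def using fin codes by (intro card_image_le) auto
    also have "\<dots> = card cells * card codes" by (rule card_cartesian_product)
    also have "\<dots> \<le> (card S + 1) ^ m * (card S * 2 + 1) ^ m"
      unfolding cells_def by (intro mult_mono card_sign_patterns[OF S(1) W] codes(2)) auto
    also have "\<dots> \<le> (r + m + 1) ^ m * (2 * (r + m) + 1) ^ m"
      using S T(2) by (intro mult_mono power_mono) (auto simp: q_def)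
    finally show "card \<C> \<le> ((r + m + 1) * (2 * (r + m) + 1)) ^ m"
      by (simp only: power_mult_distrib)
    fix h assume h: "h \<in> W"
    define \<sigma> where "\<sigma> = {s\<in>S. h s \<ge> 0}"
    have hc: "h \<in> cone W S \<sigma> {}" using h by (auto simp: cone_def vanishing_def \<sigma>_def)
    have "dim_le m (vanishing W {})" using W(2) by (simp add: vanishing_def)
    from flag_decomposition[OF W(1) S(1) sep pick this _ hc]
    obtain cs where cs: "length cs \<le> m" "set cs \<subseteq> S \<times> UNIV" "pos_comb (flag_rays (pick \<sigma>) {} cs) h"
      "\<forall>v\<in>set (flag_rays (pick \<sigma>) {} cs). v \<in> cone W S \<sigma> {} \<and> extremal W S m v" by auto
    define vs where "vs = flag_rays (pick \<sigma>) {} cs"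
    have vs: "length vs \<le> m" "pos_comb vs h" "\<And>v. v \<in> set vs \<Longrightarrow> v \<in> cone W S \<sigma> {}"
      "\<And>v. v \<in> set vs \<Longrightarrow> extremal W S m v"
      using cs length_flag_rays[of "pick \<sigma>" "{}" cs] by (auto simp: vs_def)
    have conf: "v s * v' s \<ge> 0" if "v \<in> set vs" "v' \<in> set vs" "s \<in> S" for v v' s
      using vs(3)[OF that(1)] vs(3)[OF that(2)] that(3)
      by (cases "s \<in> \<sigma>") (auto simp: cone_def mult_nonpos_nonpos)
    have "pos vs \<in> \<C>"
      unfolding \<C>_def vs_def using h cs by (auto simp: cells_def codes_def \<sigma>_def intro!: image_eqI[of _ _ "(\<sigma>, cs)"])
    moreover have "{p\<in>U. h p > 0} \<subseteq> pos vs"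
      using pos_comb_nonpos[OF vs(2)] by (auto simp: pos_def) (meson linorder_not_le)
    moreover have "real (card (pos vs - {p\<in>U. h p > 0})) \<le> \<epsilon> * real (card U)"
    proof -
      let ?P = "set vs \<times> set vs"
      let ?X = "\<lambda>z. {p\<in>U. fst z p * snd z p < 0}"
      have "pos vs - {p\<in>U. h p > 0} \<subseteq> (\<Union>z\<in>?P. ?X z)"
      proof
        fix p assume p: "p \<in> pos vs - {p\<in>U. h p > 0}"
        then obtain v where v: "v \<in> set vs" "v p > 0" "p \<in> U" by (auto simp: pos_def)
        have "\<not> h p > 0" using p v(3) by simp
        then have "\<not> (\<forall>v\<in>set vs. v p \<ge> 0)" using pos_comb_pos[OF vs(2)] v(1,2) by blast
        then obtain v' where v': "v' \<in> set vs" "v' p < 0" by (auto simp: not_le)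
        have "v p * v' p < 0" using v v' by (simp add: mult_pos_neg)
        then show "p \<in> (\<Union>z\<in>?P. ?X z)" using v v' by force
      qed
      then have "card (pos vs - {p\<in>U. h p > 0}) \<le> card (\<Union>z\<in>?P. ?X z)"
        using U by (intro card_mono) auto
      also have "\<dots> \<le> (\<Sum>z\<in>?P. card (?X z))" by (rule card_UN_le) simp
      finally have "real (card (pos vs - {p\<in>U. h p > 0})) \<le> real (\<Sum>z\<in>?P. card (?X z))"
        by (simp only: of_nat_le_iff)
      also have "\<dots> = (\<Sum>z\<in>?P. real (card (?X z)))" by (rule of_nat_sum)
      also have "\<dots> \<le> (\<Sum>z\<in>?P. \<epsilon>' * real (card U))"
        by (intro sum_mono cross) (auto intro: vs(4) conf)
      also have "\<dots> = real (card ?P) * (\<epsilon>' * real (card U))" by simp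
      also have "\<dots> \<le> real (m ^ 2) * (\<epsilon>' * real (card U))"
      proof (intro mult_right_mono)
        have "card (set vs) \<le> m" using card_length vs(1) le_trans by blast
        then have "card ?P \<le> m * m" by (simp add: card_cartesian_product mult_mono)
        then show "real (card ?P) \<le> real (m ^ 2)" by (simp add: power2_eq_square del: of_nat_mult)
      qed (use \<epsilon>' in auto)
      also have "\<dots> = \<epsilon> * real (card U)" using m by (simp add: \<epsilon>'_def)
      finally show ?thesis .
    qed
    ultimately show "\<exists>C\<in>\<C>. {p\<in>U. h p > 0} \<subseteq> C \<and>
       real (card (C - {p\<in>U. h p > 0})) \<le> \<epsilon> * real (card U)" by blast
  qed
qed

section \<open>Choice of the sample size and application to halfspaces\<close>

lemma lin_closed_span: "lin_closed {w. \<exists>c. w = (\<lambda>p. \<Sum>i\<in>I. c i * g i p)}"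
  unfolding lin_closed_def
proof safe
  fix a b :: real and c c'
  show "\<exists>c''. (\<lambda>p. a * (\<Sum>i\<in>I. c i * g i p) + b * (\<Sum>i\<in>I. c' i * g i p)) =
      (\<lambda>p. \<Sum>i\<in>I. c'' i * g i p)"
    by (intro exI[of _ "\<lambda>i. a * c i + b * c' i"])
      (simp add: sum_distrib_left sum.distrib algebra_simps)
qed

text \<open>The number of index tuples is at most z^(9m) \<le> exp(9m(z - 1)), by z \<le> exp(z -
  1). As 2m \<le> r/2, the other factor is at most exp(-e r/2) with e = \<epsilon>/m^2. The factor
  \<open>18 * m ^ 3 * N\<close> in \<open>z\<close> makes e r/2 equal to 9mz times \<epsilon>N,
  hence at least 9mz.\<close>

lemma sample_size:
  fixes \<epsilon> :: real
  assumes m: "m \<ge> 1" and \<epsilon>: "0 < \<epsilon>" "\<epsilon> \<le> 1" and N: "1 \<le> \<epsilon> * real N"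
    and z: "z = 18 * m ^ 3 * N" and r: "r = z ^ 2"
  shows "r + m + 1 \<le> 2 * r"
    and "2 * real (r + m + 1) ^ (2 * m) * (1 - \<epsilon> / real m ^ 2) ^ (r - 2 * m) < 1"
proof -
  have N1: "N \<ge> 1" using N by (cases N) auto
  have "m ^ 1 \<le> m ^ 3" using m by (intro power_increasing) auto
  then have "18 * m * 1 \<le> 18 * m ^ 3 * N" using N1 by (intro mult_mono) auto
  then have zm: "18 * m \<le> z" by (simp add: z)
  then have z1: "z \<ge> 18" using m by simp
  have "18 * m * 1 \<le> z * z" using zm z1 by (intro mult_mono) auto
  then have rm: "18 * m \<le> r" by (simp add: r power2_eq_square)
  then show 1: "r + m + 1 \<le> 2 * r" using m by linarith
  define e where "e = \<epsilon> / real m ^ 2"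
  have m2: "real m ^ 2 \<ge> 1" using m by simp
  have e: "0 \<le> e" "e \<le> 1" using \<epsilon> m2 by (auto simp: e_def divide_le_eq)
  have rz: "2 * r \<le> z ^ 3" using z1 by (simp add: r power2_eq_square power3_eq_cube)
  have "2 * (r + m + 1) ^ (2 * m) \<le> (z ^ 3) ^ 1 * (z ^ 3) ^ (2 * m)"
  proof -
    have "r + m + 1 \<le> z ^ 3" using 1 rz by linarith
    moreover have "2 \<le> z ^ 3" using rz rm m by linarith
    ultimately show ?thesis
      unfolding power_one_right by (meson mult_le_mono power_mono zero_le)
  qed
  also have "\<dots> = (z ^ 3) ^ (1 + 2 * m)" by (simp only: power_add)
  also have "\<dots> \<le> (z ^ 3) ^ (3 * m)" using z1 m by (intro power_increasing) auto
  also have "\<dots> = z ^ (9 * m)" by (simp flip: power_mult)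
  finally have "real (2 * (r + m + 1) ^ (2 * m)) \<le> real (z ^ (9 * m))" by (simp only: of_nat_le_iff)
  then have "2 * real (r + m + 1) ^ (2 * m) \<le> real z ^ (9 * m)"
    by (simp only: of_nat_mult of_nat_power of_nat_numeral)
  also have "\<dots> \<le> exp (real z - 1) ^ (9 * m)"
    using exp_ge_add_one_self[of "real z - 1"] by (intro power_mono) auto
  also have "\<dots> = exp (9 * real m * (real z - 1))" by (simp flip: exp_of_nat_mult)
  finally have A: "2 * real (r + m + 1) ^ (2 * m) \<le> exp (9 * real m * (real z - 1))" .
  have "(1 - e) ^ (r - 2 * m) \<le> exp (- e) ^ (r - 2 * m)"
    using e exp_ge_add_one_self[of "-e"] by (intro power_mono) auto
  also have "\<dots> = exp (- (e * real (r - 2 * m)))" by (simp add: exp_of_nat_mult[symmetric] mult.commute)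
  also have "\<dots> \<le> exp (- (9 * real m * real z))"
  proof -
    have "9 * real m * real z \<le> (\<epsilon> * real N) * (9 * real m * real z)"
      using mult_right_mono[OF N, of "9 * real m * real z"] by simp
    also have "\<dots> = e * (real r / 2)"
      using m by (simp add: e_def r z power2_eq_square power3_eq_cube)
    also have "\<dots> \<le> e * real (r - 2 * m)"
      using e rm by (intro mult_left_mono) (auto simp: of_nat_diff)
    finally show ?thesis by simp
  qed
  finally have B: "(1 - e) ^ (r - 2 * m) \<le> exp (- (9 * real m * real z))" .
  have "2 * real (r + m + 1) ^ (2 * m) * (1 - e) ^ (r - 2 * m)
      \<le> exp (9 * real m * (real z - 1)) * exp (- (9 * real m * real z))"
    using A B e by (intro mult_mono) auto
  also have "\<dots> = exp (- (9 * real m))" by (simp flip: exp_add add: algebra_simps)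
  also have "\<dots> < 1" using m by simp
  finally show "2 * real (r + m + 1) ^ (2 * m) * (1 - \<epsilon> / real m ^ 2) ^ (r - 2 * m) < 1"
    by (simp add: e_def)
qed

text \<open>Containers are built for strict inequalities only. On a finite set a closed threshold
  can be raised to the next larger value of the functional.\<close>

lemma halfspace_trace_open:
  assumes "finite U" "U \<subseteq> carrier_vec d" "F \<in> halfspace_traces d U"
  obtains a b where "a \<in> carrier_vec d" "F = {x \<in> U. a \<bullet> x < b}"
proof -
  obtain H where H: "H \<in> halfspaces d" "F = H \<inter> U"
    using assms(3) by (auto simp: halfspace_traces_def)
  then consider a b where "a \<in> carrier_vec d" "H = {x \<in> carrier_vec d. a \<bullet> x < b}"
    | a b where "a \<in> carrier_vec d" "H = {x \<in> carrier_vec d. a \<bullet> x \<le> b}"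
    by (auto simp: halfspaces_def)
  then show ?thesis
  proof cases
    case 1
    then have "F = {x \<in> U. a \<bullet> x < b}" using H(2) assms(2) by blast
    with 1 that show ?thesis by blast
  next
    case 2
    \<comment> \<open>The entry \<open>b + 1\<close> keeps the minimum defined when no point of
      \<open>U\<close> lies beyond the threshold.\<close>
    define M where "M = insert (b + 1) ((\<lambda>x. a \<bullet> x) ` {x\<in>U. a \<bullet> x > b})"
    have M: "finite M" "M \<noteq> {}" using assms(1) by (auto simp: M_def)
    have "b < Min M" using M by (subst Min_gr_iff) (auto simp: M_def)
    moreover have "Min M \<le> a \<bullet> x" if "x \<in> U" "a \<bullet> x > b" for x
      using M that by (intro Min_le) (auto simp: M_def)
    ultimately have "a \<bullet> x \<le> b \<longleftrightarrow> a \<bullet> x < Min M" if "x \<in> U" for x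
      using that by (meson le_less_trans not_le)
    then have "F = {x \<in> U. a \<bullet> x < Min M}" using 2 H(2) assms(2) by blast
    with 2 that show ?thesis by blast
  qed
qed

text \<open>The base \<open>B \<ge> 2\<close> absorbs all constants: 288 \<le> B^9 gives z \<le>
  B^12, and 8 \<le> B^3 gives 8 z^4 \<le> B^51. Finally 51 (d + 1) \<le> 102 d.\<close>

lemma container_count:
  fixes \<epsilon> :: real
  assumes d: "d \<ge> 1" and \<epsilon>: "0 < \<epsilon>" "\<epsilon> \<le> 1" and N: "real N \<le> 2 / \<epsilon>"
    and z: "z = 18 * (d + 1) ^ 3 * N" and r: "r = z ^ 2"
    and c: "c \<le> ((r + (d + 1) + 1) * (2 * (r + (d + 1)) + 1)) ^ (d + 1)"
    and rm: "r + (d + 1) + 1 \<le> 2 * r"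
  shows "real c \<le> (max 2 (real d / \<epsilon>)) powr (102 * real d)"
proof -
  define B where "B = max 2 (real d / \<epsilon>)"
  have B: "B \<ge> 2" "real d / \<epsilon> \<le> B" by (auto simp: B_def)
  have "(r + (d + 1) + 1) * (2 * (r + (d + 1)) + 1) \<le> (2 * r) * (4 * r)"
    using rm by (intro mult_mono) auto
  then have "c \<le> (8 * r ^ 2) ^ (d + 1)"
    using c by (elim order.trans) (intro power_mono, auto simp: power2_eq_square)
  then have 1: "real c \<le> (8 * real z ^ 4) ^ (d + 1)"
    unfolding r by (metis (mono_tags, lifting) of_nat_le_iff of_nat_mult of_nat_numeral of_nat_power
        power_mult numeral_Bit0 mult_2)
  have "real z = 18 * (real d + 1) ^ 3 * real N" by (simp add: z add.commute)
  also have "\<dots> \<le> 18 * (2 * real d) ^ 3 * (2 / \<epsilon>)"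
    using d N by (intro mult_mono power_mono) auto
  also have "\<dots> = 288 * (real d ^ 3 * (1 / \<epsilon>))" by (simp add: power_mult_distrib)
  also have "\<dots> \<le> 288 * (real d ^ 3 * (1 / \<epsilon>) ^ 3)"
    using \<epsilon> power_increasing[of 1 3 "1 / \<epsilon>"] by (intro mult_left_mono) auto
  also have "\<dots> = 288 * (real d / \<epsilon>) ^ 3" by (simp add: power_divide)
  also have "\<dots> \<le> 2 ^ 9 * B ^ 3" using B \<epsilon> by (intro mult_mono power_mono) auto
  also have "\<dots> \<le> B ^ 9 * B ^ 3" using B by (intro mult_mono power_mono) auto
  also have "\<dots> = B ^ 12" by (simp flip: power_add)
  finally have "real z \<le> B ^ 12" .
  then have "real z ^ 4 \<le> (B ^ 12) ^ 4" by (intro power_mono) auto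
  moreover have "(2::real) ^ 3 \<le> B ^ 3" using B by (intro power_mono) auto
  ultimately have "8 * real z ^ 4 \<le> B ^ 3 * (B ^ 12) ^ 4"
    using B by (intro mult_mono) auto
  also have "\<dots> = B ^ 51" by (simp flip: power_add power_mult)
  finally have "(8 * real z ^ 4) ^ (d + 1) \<le> (B ^ 51) ^ (d + 1)" by (intro power_mono) auto
  also have "\<dots> = B ^ (51 * (d + 1))" by (simp only: power_mult)
  also have "\<dots> \<le> B ^ (102 * d)" using B d by (intro power_increasing) auto
  also have "\<dots> = B powr (102 * real d)" using B powr_realpow[of B "102 * d"] by simp
  finally show ?thesis using 1 by (simp add: B_def)
qed

theorem mainTheorem5:
  shows "\<exists>K::real. \<forall>d::nat. d \<ge> 1 \<longrightarrow>
    (\<forall>U. U \<subseteq> carrier_vec d \<longrightarrow> finite U \<longrightarrow>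
      (\<forall>\<epsilon>::real. \<epsilon> > 0 \<longrightarrow>
        (\<exists>\<C>. eps_containers \<epsilon> U (halfspace_traces d U) \<C> \<and>
             real (card \<C>) \<le> (max 2 (real d / \<epsilon>)) powr (K * real d))))"
proof (intro exI[of _ 102] allI impI)
  fix d :: nat and U :: "real vec set" and \<epsilon> :: real
  assume d: "d \<ge> 1" and U: "U \<subseteq> carrier_vec d" "finite U" and \<epsilon>: "\<epsilon> > 0"
  show "\<exists>\<C>. eps_containers \<epsilon> U (halfspace_traces d U) \<C> \<and>
             real (card \<C>) \<le> (max 2 (real d / \<epsilon>)) powr (102 * real d)"
  \<comment> \<open>In these cases \<open>U\<close> alone is a container for every trace; sampling
    requires a nonempty \<open>U\<close> and \<epsilon> \<le> 1.\<close>
  proof (cases "U = {} \<or> \<epsilon> > 1")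
    case True
    have "real (card (U - F)) \<le> \<epsilon> * real (card U)" for F
    proof -
      have "card (U - F) \<le> card U" using U(2) by (intro card_mono) auto
      moreover have "1 * real (card U) \<le> \<epsilon> * real (card U)"
      proof (cases "U = {}")
        case False
        then show ?thesis using True by (intro mult_right_mono) auto
      qed simp
      ultimately show ?thesis by simp
    qed
    then have "eps_containers \<epsilon> U (halfspace_traces d U) {U}"
      by (auto simp: eps_containers_def halfspace_traces_def)
    moreover have "1 \<le> (max 2 (real d / \<epsilon>)) powr (102 * real d)"
      by (intro ge_one_powr_ge_zero) auto
    ultimately show ?thesis by (intro exI[of _ "{U}"]) simp
  next
    case False
    then have ne: "U \<noteq> {}" and \<epsilon>1: "\<epsilon> \<le> 1" by auto
    define N where "N = nat \<lceil>1 / \<epsilon>\<rceil>"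
    have "1 / \<epsilon> \<le> real N" unfolding N_def by linarith
    then have N1: "1 \<le> \<epsilon> * real N" using \<epsilon> by (simp add: field_simps)
    have "real N \<le> 1 / \<epsilon> + 1" using \<epsilon> unfolding N_def by simp
    also have "\<dots> \<le> 2 / \<epsilon>" using \<epsilon> \<epsilon>1 by (simp add: field_simps)
    finally have N2: "real N \<le> 2 / \<epsilon>" .
    define z where "z = 18 * (d + 1) ^ 3 * N"
    define r where "r = z ^ 2"
    \<comment> \<open>The coordinate functions and, at index \<open>d\<close>, the constant 1
      generate the affine functionals. Cutting them off outside \<open>U\<close> makes an element of
      \<open>W\<close> zero as soon as it vanishes on \<open>U\<close>.\<close>
    define g where "g i p = (if p \<in> U then if i < d then p $ i else 1 else 0)" for i :: nat and p :: "real vec"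
    define W where "W = {w. \<exists>c. w = (\<lambda>p. \<Sum>i\<le>d. c i * g i p)}"
    have W: "lin_closed W" "dim_le (d + 1) W"
      unfolding W_def by (rule lin_closed_span, rule dim_le_span) auto
    have supp: "\<forall>w\<in>W. \<forall>p. p \<notin> U \<longrightarrow> w p = 0" by (auto simp: W_def g_def)
    note size = sample_size[OF _ \<epsilon> \<epsilon>1 N1 z_def r_def]
    obtain \<C> where \<C>: "\<C> \<subseteq> Pow U"
      "card \<C> \<le> ((r + (d + 1) + 1) * (2 * (r + (d + 1)) + 1)) ^ (d + 1)"
      "\<And>h. h \<in> W \<Longrightarrow> \<exists>C\<in>\<C>. {p\<in>U. h p > 0} \<subseteq> C \<and>
         real (card (C - {p\<in>U. h p > 0})) \<le> \<epsilon> * real (card U)"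
      using container_family[OF W U(2) ne supp _ \<epsilon> \<epsilon>1 size(2)] by auto
    have "\<exists>C\<in>\<C>. F \<subseteq> C \<and> real (card (C - F)) \<le> \<epsilon> * real (card U)"
      if trace: "F \<in> halfspace_traces d U" for F
    proof -
      obtain a b where a: "a \<in> carrier_vec d" and F: "F = {x \<in> U. a \<bullet> x < b}"
        using halfspace_trace_open[OF U(2,1) trace] .
      \<comment> \<open>The signs are reversed because containers are built for sets
        \<open>h > 0\<close>, while the trace is \<open>a \<bullet> x < b\<close>.\<close>
      define c where "c i = (if i < d then - (a $ i) else b)" for i
      define h where "h = (\<lambda>p. \<Sum>i\<le>d. c i * g i p)"
      have h: "h p = b - a \<bullet> p" if p: "p \<in> U" for p
      proof -
        have "h p = (\<Sum>i<d. c i * g i p) + c d * g d p"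
          unfolding h_def by (simp add: lessThan_Suc_atMost[symmetric])
        also have "(\<Sum>i<d. c i * g i p) = (\<Sum>i<d. - (a $ i * p $ i))"
          by (intro sum.cong) (auto simp: c_def g_def p)
        also have "\<dots> = - (a \<bullet> p)"
          using p U(1) by (auto simp: scalar_prod_def sum_negf atLeast0LessThan)
        finally show ?thesis by (simp add: c_def g_def p)
      qed
      have "h \<in> W" by (auto simp: W_def h_def)
      moreover have "{p\<in>U. h p > 0} = F" using h by (auto simp: F)
      ultimately show ?thesis using \<C>(3)[of h] by simp
    qed
    then have "eps_containers \<epsilon> U (halfspace_traces d U) \<C>"
      using \<C>(1) by (simp add: eps_containers_def)
    moreover have "real (card \<C>) \<le> (max 2 (real d / \<epsilon>)) powr (102 * real d)"
      using container_count[OF d \<epsilon> \<epsilon>1 N2 z_def r_def \<C>(2)] size(1) by simp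
    ultimately show ?thesis by blast
  qed
qed

end
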